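(* Let $P(z)$ be a self-inversive polynomial of degree $n$ with complex coefficients. Then for every complex number $\alpha$ and every real $p \ge 1$, $$\left\{ \int_0^{2\pi} \left| D_\alpha P(e^{i\theta}) \right|^p \, d\theta \right\}^{1/p} \le n(|\alpha| + 1)\, C_p \left\{ \int_0^{2\pi} \left| P(e^{i\theta}) \right|^p \, d\theta \right\}^{1/p},$$ where $$C_p = \left\{ \frac{1}{2\pi}\int_0^{2\pi} \left| 1 + e^{i\beta} \right|^p \, d\beta \right\}^{-1/p}.$$
   Context: For a polynomial $P(z)$ of degree $n$ and a complex number $\alpha$, the polar derivative of $P$ with respect to $\alpha$ is the polynomial $D_\alpha P(z) = nP(z) + (\alpha - z)P'(z)$, where $P'$ is the ordinary derivative. A polynomial $P(z)$ of degree $n$ is called self-inversive if $P(z) = Q(z)$ identically, where $Q(z) = z^n\overline{P(1/\bar z)}$; that is, if $P(z) = \sum_{k=0}^n a_k z^k$, then $Q(z) = \sum_{k=0}^n \overline{a_{n-k}}\, z^k$. *)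

theory Defs
  imports "HOL-Analysis.Analysis" "HOL-Computational_Algebra.Polynomial"
begin

definition polar_deriv :: "complex \<Rightarrow> complex poly \<Rightarrow> complex poly" where
  "polar_deriv \<alpha> P = smult (of_nat (degree P)) P + [:\<alpha>, -1:] * pderiv P"

lemma poly_polar_deriv:
  "poly (polar_deriv \<alpha> P) z = of_nat (degree P) * poly P z + (\<alpha> - z) * poly (pderiv P) z"
  by (simp add: polar_deriv_def algebra_simps)

text \<open>The polynomial \<open>Q(z) = z\<^sup>n cnj (P (1 / cnj z))\<close>, where \<open>n\<close> is the degree of \<open>P\<close>;
  the two lemmas below give its coefficients and its values.\<close>

definition conj_reciprocal :: "complex poly \<Rightarrow> complex poly" where
  "conj_reciprocal P = map_poly cnj (reflect_poly P)"

lemma coeff_conj_reciprocal: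
  "coeff (conj_reciprocal P) k = (if k \<le> degree P then cnj (coeff P (degree P - k)) else 0)"
  by (simp add: conj_reciprocal_def coeff_map_poly coeff_reflect_poly)

lemma poly_conj_reciprocal:
  assumes "z \<noteq> 0"
  shows "poly (conj_reciprocal P) z = z ^ degree P * cnj (poly P (1 / cnj z))"
proof -
  have "poly (conj_reciprocal P) z = cnj (poly (reflect_poly P) (cnj z))"
    by (simp add: conj_reciprocal_def)
  also have "\<dots> = z ^ degree P * cnj (poly P (1 / cnj z))"
    using assms by (subst poly_reflect_poly_nz) (simp_all add: divide_inverse)
  finally show ?thesis .
qed

definition self_inversive :: "complex poly \<Rightarrow> bool" where
  "self_inversive P \<longleftrightarrow> P = conj_reciprocal P"

definition C_const :: "real \<Rightarrow> real" where
  "C_const p =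
     (1 / (2 * pi) * integral {0..2 * pi} (\<lambda>\<beta>. norm (1 + exp (\<i> * of_real \<beta>)) powr p)) powr (- (1 / p))"

end

theory Submission
  imports Defs
begin

text \<open>
  Write \<open>A = n P - z P'\<close>, which is \<open>D\<^sub>0 P\<close>, and \<open>B = z P'\<close>, so that \<open>D\<^sub>\<alpha> P = A + \<alpha> P'\<close>.
  If \<open>P\<close> is self-inversive, then \<open>A = z\<^sup>n cnj B\<close> on the unit circle: passing from \<open>B\<close> to \<open>A\<close>
  turns the factor \<open>k\<close> of the \<open>k\<close>-th coefficient into \<open>n - k\<close>, and conjugate-reversal of the
  coefficients does the same (\<open>self_inversive_polar_deriv_0\<close>). Hence \<open>|A| = |B| = |P'|\<close> there and
  \<open>|D\<^sub>\<alpha> P| \<le> (|\<alpha>| + 1) |P'|\<close>. It remains to prove the case of the ordinary derivative,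
  \<open>\<integral>|P'|\<^sup>p \<le> n\<^sup>p C\<^sub>p\<^sup>p \<integral>|P|\<^sup>p\<close>.

  For this, average \<open>|A + w B|\<^sup>p\<close> over all unimodular \<open>w\<close>. At a fixed point of the circle
  \<open>|A| = |B|\<close>, so the average over \<open>w\<close> is \<open>|P'|\<^sup>p\<close> times that of \<open>|1 + w|\<^sup>p\<close>; this is where
  \<open>C\<^sub>p\<close> comes from (\<open>integral_norm_add_cis_mult\<close>). For a fixed \<open>w\<close>, on the other hand,
  \<open>\<integral>|A + w B|\<^sup>p \<le> n\<^sup>p \<integral>|P|\<^sup>p\<close> for every polynomial \<open>P\<close> of degree \<open>n\<close>
  (\<open>integral_polar_deriv_0_twisted_le\<close>). The two facts combine by exchanging the order of
  integration (\<open>self_inversive_integral_pderiv_le\<close>).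

  The bound for fixed \<open>w\<close> rests on an interpolation formula of M. Riesz type
  (\<open>riesz_interpolation_weights\<close>): \<open>A(z) + w B(z) = n \<Sum>\<^sub>j c\<^sub>j P(v\<^sub>j z)\<close>, where the \<open>v\<^sub>j\<close> are the
  \<open>n\<close>-th roots of \<open>w\<close> and the weights \<open>c\<^sub>j\<close> are nonnegative with sum 1. By convexity of
  \<open>x\<^sup>p\<close> and rotation invariance of the integral, such an average of rotated copies of \<open>P\<close> has
  \<open>L\<^sup>p\<close> norm at most that of \<open>P\<close>.
\<close>

section \<open>Convexity and integrals over the unit circle\<close>

lemma convex_on_powr_nonneg:
  fixes p :: real
  assumes "p \<ge> 1"
  shows "convex_on {0..} (\<lambda>x::real. x powr p)"
proof (rule convex_onI)
  fix t x y :: real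
  assume t: "0 < t" "t < 1" and xy: "x \<in> {0..}" "y \<in> {0..}"
  \<comment> \<open>An endpoint at \<open>0\<close> is where the second derivative may fail to exist; there convexity is
    this scaling inequality.\<close>
  have scale: "(s * r) powr p \<le> s * r powr p" if "0 < s" "s < 1" "0 \<le> r" for s r :: real
  proof -
    have "s powr p \<le> s"
      using powr_mono'[of 1 p s] that assms by simp
    then show ?thesis
      using that by (simp add: powr_mult mult_right_mono)
  qed
  consider "x = 0" | "y = 0" | "x > 0" "y > 0"
    using xy by fastforce
  then show "((1 - t) *\<^sub>R x + t *\<^sub>R y) powr p \<le> (1 - t) * x powr p + t * y powr p"
  proof cases
    case 1
    then show ?thesis using scale[of t y] t xy by simp
  next
    case 2
    then show ?thesis using scale[of "1 - t" x] t xy by simp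
  next
    case 3
    then show ?thesis
      using convex_onD[OF powr_convex[OF assms], of t x y] t by simp
  qed
qed simp

lemma norm_convex_sum_powr_le:
  fixes c :: "'a \<Rightarrow> real" and x :: "'a \<Rightarrow> 'b :: real_normed_vector"
  assumes "finite S" "\<And>j. j \<in> S \<Longrightarrow> c j \<ge> 0" "(\<Sum>j\<in>S. c j) = 1" "p \<ge> 1"
  shows "norm (\<Sum>j\<in>S. c j *\<^sub>R x j) powr p \<le> (\<Sum>j\<in>S. c j * norm (x j) powr p)"
proof -
  have "S \<noteq> {}"
    using assms(3) by auto
  have "norm (\<Sum>j\<in>S. c j *\<^sub>R x j) \<le> (\<Sum>j\<in>S. c j * norm (x j))"
    by (rule order_trans[OF norm_sum]) (simp add: assms(2))
  then have "norm (\<Sum>j\<in>S. c j *\<^sub>R x j) powr p \<le> (\<Sum>j\<in>S. c j * norm (x j)) powr p"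
    using assms(4) by (intro powr_mono2) auto
  also have "\<dots> \<le> (\<Sum>j\<in>S. c j * norm (x j) powr p)"
    using convex_on_sum[OF assms(1) \<open>S \<noteq> {}\<close> convex_on_powr_nonneg[OF assms(4)] assms(3,2),
        of "\<lambda>j. norm (x j)"]
    by simp
  finally show ?thesis .
qed

lemma continuous_on_circle_param:
  assumes "continuous_on (sphere 0 1) f"
  shows "continuous_on A (\<lambda>\<theta>. f (cis \<theta>))"
  by (rule continuous_on_compose2[OF assms]) (auto intro!: continuous_intros)

text \<open>
  With \<open>u = cis s\<close>, the rotated integral runs over \<open>{s..2 * pi + s}\<close>; by periodicity the part
  beyond \<open>2 * pi\<close> fills the gap \<open>{0..s}\<close>.
\<close>

lemma integral_circle_rotate:
  fixes f :: "complex \<Rightarrow> real"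
  assumes f: "continuous_on (sphere 0 1) f" and u: "norm u = 1"
  shows "integral {0..2 * pi} (\<lambda>\<theta>. f (u * cis \<theta>)) = integral {0..2 * pi} (\<lambda>\<theta>. f (cis \<theta>))"
proof -
  define s where "s = Arg2pi u"
  have s: "0 \<le> s" "s \<le> 2 * pi"
    using Arg2pi_ge_0[of u] Arg2pi_lt_2pi[of u] by (simp_all add: s_def)
  have us: "u = cis s"
    using Arg2pi_eq[of u] u by (simp add: s_def cis_conv_exp)
  define g where "g \<theta> = f (cis \<theta>)" for \<theta>
  have int: "g integrable_on {a..b}" for a b
    unfolding g_def by (intro integrable_continuous_real continuous_on_circle_param f)
  have "integral {0..2 * pi} (\<lambda>\<theta>. f (u * cis \<theta>)) = integral {0..2 * pi} (\<lambda>\<theta>. g (\<theta> + s))"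
    by (simp add: g_def us cis_mult add.commute)
  also have "\<dots> = integral {s..2 * pi + s} g"
    using integral_shift_real_ivl[of s s "2 * pi + s" g] by simp
  also have "\<dots> = integral {s..2 * pi} g + integral {2 * pi..2 * pi + s} g"
    using s int by (intro Henstock_Kurzweil_Integration.integral_combine[symmetric]) auto
  also have "integral {2 * pi..2 * pi + s} g = integral {0..s} (\<lambda>\<theta>. g (\<theta> + 2 * pi))"
    using integral_shift_real_ivl[of "2 * pi" "2 * pi" "2 * pi + s" g] by simp
  also have "\<dots> = integral {0..s} g"
    by (simp add: g_def[abs_def] flip: cis_mult)
  also have "integral {s..2 * pi} g + integral {0..s} g = integral {0..2 * pi} g"
    using s int Henstock_Kurzweil_Integration.integral_combine[of 0 s "2 * pi" g] by simp
  finally show ?thesis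
    by (simp add: g_def[abs_def])
qed

section \<open>Riesz interpolation at the roots of a unimodular number\<close>

text \<open>
  Discrete orthogonality on the \<open>n\<close>-th roots of \<open>cis \<beta>\<close>: the summands form a geometric
  progression whose ratio is an \<open>n\<close>-th root of unity, different from 1 unless \<open>k = l\<close>.
\<close>

lemma sum_nth_roots_powers:
  fixes n :: nat and \<beta> :: real
  defines "v \<equiv> \<lambda>j. cis ((\<beta> + 2 * pi * real j) / real n)"
  assumes "k < n" "l < n"
  shows "(\<Sum>j<n. v j ^ k * cnj (v j) ^ l) = (if k = l then of_nat n else 0)"
proof -
  define d where "d = real k - real l"
  define q where "q = cis (d * (2 * pi / real n))"
  have term_eq: "v j ^ k * cnj (v j) ^ l = cis (d * \<beta> / real n) * q ^ j" for j
  proof -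
    have "v j ^ k * cnj (v j) ^ l = cis (d * ((\<beta> + 2 * pi * real j) / real n))"
      by (simp add: v_def d_def cis_cnj Complex.DeMoivre cis_mult left_diff_distrib diff_divide_distrib)
    also have "d * ((\<beta> + 2 * pi * real j) / real n)
        = d * \<beta> / real n + real j * (d * (2 * pi / real n))"
      by (simp add: add_divide_distrib distrib_left mult_ac)
    finally show ?thesis
      by (simp add: q_def Complex.DeMoivre cis_mult)
  qed
  show ?thesis
  proof (cases "k = l")
    case True
    have "v j ^ k * cnj (v j) ^ l = 1" for j
      unfolding term_eq using True by (simp add: d_def q_def)
    with True show ?thesis
      by simp
  next
    case False
    have "real n * (d * (2 * pi / real n)) = 2 * pi * of_int (int k - int l)"
      using assms(2) by (simp add: d_def)
    then have "q ^ n = cis (2 * pi * of_int (int k - int l))"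
      by (simp only: q_def Complex.DeMoivre)
    then have qn: "q ^ n = 1"
      by (metis cis_multiple_2pi Ints_of_int)
    have "q \<noteq> 1"
    proof
      assume "q = 1"
      then obtain m :: int where m: "d * (2 * pi / real n) = of_int m * 2 * pi"
        unfolding q_def cis_conv_exp by (auto simp: exp_eq_1)
      then have "d = of_int (m * int n)"
        using assms by (simp add: field_simps)
      then have "int k - int l = m * int n"
        unfolding d_def by linarith
      moreover have "\<bar>int k - int l\<bar> < int n" "int k - int l \<noteq> 0"
        using assms False by auto
      ultimately show False
        by (metis dvd_imp_le_int dvd_triv_right abs_of_nat linorder_not_less)
    qed
    then have "(\<Sum>j<n. q ^ j) = 0"
      using qn by (simp add: sum_gp_strict)
    then show ?thesis
      using False by (simp add: term_eq flip: sum_distrib_left)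
  qed
qed

text \<open>
  The expansion of the squared geometric sum, i.e. \<open>n\<close> times the Fejer kernel, has frequencies
  between \<open>1 - n\<close> and \<open>n - 1\<close>. On the roots of \<open>v ^ n = w\<close> a frequency can be shifted by \<open>n\<close> at
  the price of a factor \<open>w\<close>, which folds the expansion into the powers \<open>cnj v ^ k\<close> with \<open>k < n\<close>.
  The coefficients that result are the multipliers of the operator sending \<open>P\<close> to
  \<open>n P - z P' + w z P'\<close>. As the left-hand side is nonnegative, so will be the interpolation weights.
\<close>

lemma geometric_sum_square:
  fixes v w :: complex
  assumes v: "norm v = 1" and vn: "v ^ n = w"
  shows "of_real ((norm (\<Sum>k<n. v ^ k))\<^sup>2)
    = (\<Sum>k<n. (of_nat (n - k) + of_nat k * w) * cnj v ^ k)"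
proof -
  have inv: "v * cnj v = 1"
    using v complex_norm_square[of v] by simp
  \<comment> \<open>Multiplication by \<open>v\<close> rotates the terms cyclically; the one that wraps around picks up \<open>w\<close>.\<close>
  have shift: "v ^ l * (\<Sum>k<n. cnj v ^ k) = (\<Sum>k<n. (if k + l < n then 1 else w) * cnj v ^ k)"
    if "l \<le> n" for l
    using that
  proof (induction l)
    case 0
    then show ?case by simp
  next
    case (Suc l)
    obtain m where n: "n = Suc m" using Suc.prems by (cases n) auto
    have "v ^ Suc l * (\<Sum>k<n. cnj v ^ k)
        = v * (\<Sum>k<Suc m. (if k + l < n then 1 else w) * cnj v ^ k)"
      using Suc n by simp
    also have "\<dots> = v * (1 + (\<Sum>k<m. (if Suc k + l < n then 1 else w) * cnj v ^ Suc k))"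
      using Suc.prems by (subst sum.lessThan_Suc_shift) simp
    also have "\<dots> = v + (\<Sum>k<m. v * cnj v * ((if Suc k + l < n then 1 else w) * cnj v ^ k))"
      by (simp add: distrib_left sum_distrib_left mult_ac)
    also have "\<dots> = w * cnj v ^ m + (\<Sum>k<m. (if k + Suc l < n then 1 else w) * cnj v ^ k)"
    proof -
      have "w * cnj v ^ m = v * (v * cnj v) ^ m"
        using n vn by (simp add: power_mult_distrib mult_ac)
      then show ?thesis
        by (simp add: inv)
    qed
    also have "\<dots> = (\<Sum>k<Suc m. (if k + Suc l < n then 1 else w) * cnj v ^ k)"
      by (simp add: n add.commute)
    finally show ?case
      using n by simp
  qed
  have count: "(\<Sum>l<n. if k + l < n then 1 else w) = of_nat (n - k) + of_nat k * w" if "k < n" for k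
  proof -
    have "(\<Sum>l<n. if k + l < n then 1 else w)
        = of_nat (card {l\<in>{..<n}. k + l < n}) + of_nat (card {l\<in>{..<n}. \<not> k + l < n}) * w"
      by (simp add: sum.If_cases Int_def Compl_eq)
    also have "{l\<in>{..<n}. k + l < n} = {..<n - k}" by auto
    also have "{l\<in>{..<n}. \<not> k + l < n} = {n - k..<n}" by auto
    finally show ?thesis using that by simp
  qed
  have "of_real ((norm (\<Sum>k<n. v ^ k))\<^sup>2) = (\<Sum>l<n. v ^ l) * (\<Sum>k<n. cnj v ^ k)"
    by (simp only: complex_norm_square cnj_sum complex_cnj_power)
  also have "\<dots> = (\<Sum>l<n. \<Sum>k<n. (if k + l < n then 1 else w) * cnj v ^ k)"
    by (simp add: sum_distrib_right shift)
  also have "\<dots> = (\<Sum>k<n. (\<Sum>l<n. if k + l < n then 1 else w) * cnj v ^ k)"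
    by (subst sum.swap) (simp add: sum_distrib_right)
  also have "\<dots> = (\<Sum>k<n. (of_nat (n - k) + of_nat k * w) * cnj v ^ k)"
    by (simp add: count)
  finally show ?thesis .
qed

text \<open>
  The multipliers \<open>m k = (n - k) + k w\<close>, where \<open>w = cis \<beta>\<close>, are realised on the \<open>n\<close>-th roots of
  \<open>w\<close>. For \<open>k < n\<close> the weights are found by inverting the discrete Fourier transform. The power
  \<open>k = n\<close> comes for free, since there \<open>v j ^ n = w\<close> and \<open>m n = w * m 0\<close>. Taking \<open>k = 0\<close> shows
  that the weights sum to 1.
\<close>

lemma riesz_interpolation_weights:
  fixes \<beta> :: real
  assumes "n > 0"
  obtains c :: "nat \<Rightarrow> real" and v :: "nat \<Rightarrow> complex"
  where "\<And>j. c j \<ge> 0" "\<And>j. norm (v j) = 1"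
    "\<And>k. k \<le> n \<Longrightarrow>
      of_nat n * (\<Sum>j<n. of_real (c j) * v j ^ k) = of_nat (n - k) + of_nat k * cis \<beta>"
proof -
  define v where "v j = cis ((\<beta> + 2 * pi * real j) / real n)" for j
  define c where "c j = (norm (\<Sum>k<n. v j ^ k))\<^sup>2 / (real n)\<^sup>2" for j
  define m where "m k = of_nat (n - k) + of_nat k * cis \<beta>" for k
  have norm_v: "norm (v j) = 1" for j
    by (simp add: v_def)
  have vn: "v j ^ n = cis \<beta>" for j
  proof -
    have "v j ^ n = cis (\<beta> + 2 * pi * real j)"
      using assms by (simp add: v_def Complex.DeMoivre)
    also have "\<dots> = cis \<beta>"
      using cis_multiple_2pi[of "real j"] by (simp flip: cis_mult)
    finally show ?thesis .
  qed
  have c_eq: "of_real (c j) = (\<Sum>k<n. m k * cnj (v j) ^ k) / (of_nat n)\<^sup>2" for j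
    using geometric_sum_square[OF norm_v vn] by (simp add: c_def m_def)
  have low: "of_nat n * (\<Sum>j<n. of_real (c j) * v j ^ k) = m k" if "k < n" for k
  proof -
    have "(\<Sum>j<n. of_real (c j) * v j ^ k)
        = (\<Sum>j<n. \<Sum>l<n. m l * (v j ^ k * cnj (v j) ^ l)) / (of_nat n)\<^sup>2"
      by (simp add: c_eq sum_distrib_right sum_divide_distrib) (simp add: mult_ac)
    also have "(\<Sum>j<n. \<Sum>l<n. m l * (v j ^ k * cnj (v j) ^ l))
        = (\<Sum>l<n. m l * (\<Sum>j<n. v j ^ k * cnj (v j) ^ l))"
      by (subst sum.swap) (simp add: sum_distrib_left)
    also have "\<dots> = (\<Sum>l<n. m l * (if k = l then of_nat n else 0))"
      unfolding v_def using that by (intro sum.cong refl, subst sum_nth_roots_powers) auto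
    also have "\<dots> = m k * of_nat n"
      using that by (simp add: if_distrib[of "\<lambda>x. _ * x"] cong: if_cong)
    finally show ?thesis
      using assms by (simp add: power2_eq_square)
  qed
  have "of_nat n * (\<Sum>j<n. of_real (c j) * v j ^ k) = m k" if "k \<le> n" for k
  proof (cases "k = n")
    case True
    have "of_nat n * (\<Sum>j<n. of_real (c j) * v j ^ n)
        = cis \<beta> * (of_nat n * (\<Sum>j<n. of_real (c j) * v j ^ 0))"
      by (simp add: vn sum_distrib_left mult_ac)
    also have "\<dots> = m n"
      using low[of 0] assms by (simp add: m_def)
    finally show ?thesis using True by simp
  qed (use that low in auto)
  then show ?thesis
    using that[of c v] norm_v by (simp add: c_def m_def)
qed

section \<open>Polar derivatives of self-inversive polynomials on the unit circle\<close>

lemma poly_eq_sum_atMost: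
  fixes P :: "'a :: comm_semiring_1 poly"
  assumes "degree P = n"
  shows "poly P z = (\<Sum>k\<le>n. coeff P k * z ^ k)"
  using assms by (simp add: poly_altdef)

lemma mult_poly_pderiv_eq_sum:
  fixes P :: "complex poly"
  assumes "degree P = n"
  shows "z * poly (pderiv P) z = (\<Sum>k\<le>n. of_nat k * coeff P k * z ^ k)"
proof -
  have "poly (pderiv P) z = (\<Sum>k<n. of_nat (Suc k) * coeff P (Suc k) * z ^ k)"
  proof -
    have "poly (pderiv P) z = (\<Sum>k\<le>degree (pderiv P). coeff (pderiv P) k * z ^ k)"
      by (simp add: poly_altdef)
    also have "\<dots> = (\<Sum>k<n. coeff (pderiv P) k * z ^ k)"
    proof (cases "n = 0")
      case True
      then show ?thesis using assms by (simp add: degree_pderiv coeff_pderiv coeff_eq_0)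
    next
      case False
      then show ?thesis using assms by (intro sum.cong) (auto simp: degree_pderiv)
    qed
    finally show ?thesis by (simp add: coeff_pderiv)
  qed
  then have "z * poly (pderiv P) z = (\<Sum>k<n. of_nat (Suc k) * coeff P (Suc k) * z ^ Suc k)"
    by (simp add: sum_distrib_left mult_ac)
  also have "\<dots> = (\<Sum>k<Suc n. of_nat k * coeff P k * z ^ k)"
    by (simp only: sum.lessThan_Suc_shift[of _ n]) simp
  finally show ?thesis
    by (simp add: lessThan_Suc_atMost)
qed

lemma polar_deriv_0_eq_sum:
  assumes "degree P = n"
  shows "poly (polar_deriv 0 P) z = (\<Sum>k\<le>n. of_nat (n - k) * coeff P k * z ^ k)"
proof -
  have "poly (polar_deriv 0 P) z = of_nat n * poly P z - z * poly (pderiv P) z"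
    by (simp add: poly_polar_deriv assms)
  also have "\<dots> = (\<Sum>k\<le>n. of_nat (n - k) * coeff P k * z ^ k)"
    unfolding mult_poly_pderiv_eq_sum[OF assms] poly_eq_sum_atMost[OF assms]
      sum_distrib_left sum_subtractf[symmetric]
    by (intro sum.cong refl) (simp add: of_nat_diff algebra_simps)
  finally show ?thesis .
qed

text \<open>
  Self-inversiveness says \<open>a\<^sub>n\<^sub>-\<^sub>k = cnj a\<^sub>k\<close>, and \<open>z ^ (n - k) = z ^ n * cnj (z ^ k)\<close> on the circle;
  so reversing the sum for \<open>D\<^sub>0 P\<close> matches its weights \<open>n - k\<close> with the weights \<open>k\<close> of \<open>z P'\<close>.
\<close>

lemma self_inversive_polar_deriv_0:
  assumes P: "self_inversive P" and z: "norm z = 1"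
  shows "poly (polar_deriv 0 P) z = z ^ degree P * cnj (z * poly (pderiv P) z)"
proof -
  define n where "n = degree P"
  have inv: "z * cnj z = 1"
    using z complex_norm_square[of z] by simp
  have coeff: "coeff P (n - k) = cnj (coeff P k)" if "k \<le> n" for k
  proof -
    have "coeff P (n - k) = coeff (conj_reciprocal P) (n - k)"
      using P by (simp add: self_inversive_def)
    then show ?thesis
      using that by (simp add: coeff_conj_reciprocal n_def)
  qed
  have pow: "z ^ (n - k) = z ^ n * cnj z ^ k" if "k \<le> n" for k
  proof -
    have "z ^ n * cnj z ^ k = z ^ (n - k) * (z * cnj z) ^ k"
      using that by (simp add: power_mult_distrib flip: power_add)
    then show ?thesis by (simp add: inv)
  qed
  have "poly (polar_deriv 0 P) z = (\<Sum>k\<le>n. of_nat (n - k) * coeff P k * z ^ k)"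
    by (simp add: polar_deriv_0_eq_sum n_def)
  also have "\<dots> = (\<Sum>k\<le>n. of_nat k * coeff P (n - k) * z ^ (n - k))"
    by (rule sum.reindex_bij_witness[of _ "\<lambda>k. n - k" "\<lambda>k. n - k"]) auto
  also have "\<dots> = (\<Sum>k\<le>n. z ^ n * cnj (of_nat k * coeff P k * z ^ k))"
    by (intro sum.cong refl) (simp add: pow coeff)
  also have "\<dots> = z ^ n * cnj (\<Sum>k\<le>n. of_nat k * coeff P k * z ^ k)"
    by (simp add: sum_distrib_left)
  also have "(\<Sum>k\<le>n. of_nat k * coeff P k * z ^ k) = z * poly (pderiv P) z"
    by (simp add: mult_poly_pderiv_eq_sum n_def)
  finally show ?thesis by (simp add: n_def)
qed

lemma norm_polar_deriv_le:
  assumes "self_inversive P" and z: "norm z = 1"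
  shows "norm (poly (polar_deriv \<alpha> P) z) \<le> (norm \<alpha> + 1) * norm (poly (pderiv P) z)"
proof -
  have "poly (polar_deriv \<alpha> P) z = poly (polar_deriv 0 P) z + \<alpha> * poly (pderiv P) z"
    by (simp add: poly_polar_deriv algebra_simps)
  also have "norm \<dots> \<le> norm (poly (polar_deriv 0 P) z) + norm (\<alpha> * poly (pderiv P) z)"
    by (rule norm_triangle_ineq)
  also have "norm (poly (polar_deriv 0 P) z) = norm (poly (pderiv P) z)"
    using z by (simp add: self_inversive_polar_deriv_0[OF assms] norm_mult norm_power)
  finally show ?thesis
    by (simp add: norm_mult algebra_simps)
qed

section \<open>Integral inequalities\<close>

lemma continuous_on_norm_poly_powr:
  assumes "p > 0"
  shows "continuous_on A (\<lambda>z::complex. norm (poly P z) powr p)"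
  using assms by (intro continuous_on_powr' continuous_intros) auto

text \<open>
  By the interpolation formula the function on the left is \<open>n\<close> times a convex combination of
  rotations of \<open>P\<close>, each of which has the same integral as \<open>P\<close>.
\<close>

lemma integral_polar_deriv_0_twisted_le:
  assumes n: "degree P = n" and p: "p \<ge> 1"
  shows "integral {0..2 * pi}
      (\<lambda>\<theta>. norm (poly (polar_deriv 0 P) (cis \<theta>) + cis \<beta> * (cis \<theta> * poly (pderiv P) (cis \<theta>))) powr p)
    \<le> real n powr p * integral {0..2 * pi} (\<lambda>\<theta>. norm (poly P (cis \<theta>)) powr p)"
proof (cases "n = 0")
  case True
  then have "pderiv P = 0"
    using n by (simp add: pderiv_eq_0_iff)
  then show ?thesis
    using True n by (simp add: poly_polar_deriv)
next
  case False
  then obtain c v where c: "\<And>j. c j \<ge> 0" and v: "\<And>j. norm (v j) = 1"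
    and interp: "\<And>k. k \<le> n \<Longrightarrow>
      of_nat n * (\<Sum>j<n. of_real (c j) * v j ^ k) = of_nat (n - k) + of_nat k * cis \<beta>"
    using riesz_interpolation_weights[of n \<beta>] by auto
  have "complex_of_real (\<Sum>j<n. c j) = 1"
    using interp[of 0] False by simp
  then have c_sum: "(\<Sum>j<n. c j) = 1"
    using of_real_eq_1_iff by blast
  have formula: "poly (polar_deriv 0 P) z + cis \<beta> * (z * poly (pderiv P) z)
      = of_nat n * (\<Sum>j<n. c j *\<^sub>R poly P (v j * z))" for z
  proof -
    have "poly (polar_deriv 0 P) z + cis \<beta> * (z * poly (pderiv P) z)
        = (\<Sum>k\<le>n. (of_nat (n - k) + of_nat k * cis \<beta>) * (coeff P k * z ^ k))"
      unfolding mult_poly_pderiv_eq_sum[OF n] polar_deriv_0_eq_sum[OF n]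
        sum_distrib_left sum.distrib[symmetric]
      by (intro sum.cong refl) (simp add: algebra_simps)
    also have "\<dots> = (\<Sum>k\<le>n. of_nat n * (\<Sum>j<n. of_real (c j) * v j ^ k) * (coeff P k * z ^ k))"
      by (simp add: interp)
    also have "\<dots> = (\<Sum>k\<le>n. \<Sum>j<n. of_nat n * (of_real (c j) * (coeff P k * (v j * z) ^ k)))"
      by (simp add: sum_distrib_left sum_distrib_right power_mult_distrib mult_ac)
    also have "\<dots> = of_nat n * (\<Sum>j<n. c j *\<^sub>R poly P (v j * z))"
      by (subst sum.swap)
        (simp add: poly_eq_sum_atMost[OF n] sum_distrib_left scaleR_conv_of_real)
    finally show ?thesis .
  qed
  define f where "f z = norm (poly P z) powr p" for z
  have f: "continuous_on A f" for A
    unfolding f_def using p by (intro continuous_on_norm_poly_powr) auto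
  have rot: "continuous_on A (\<lambda>\<theta>. f (v j * cis \<theta>))" for A j
    by (rule continuous_on_compose2[OF f[of UNIV]]) (auto intro!: continuous_intros)
  have "integral {0..2 * pi}
      (\<lambda>\<theta>. norm (poly (polar_deriv 0 P) (cis \<theta>) + cis \<beta> * (cis \<theta> * poly (pderiv P) (cis \<theta>))) powr p)
    \<le> integral {0..2 * pi} (\<lambda>\<theta>. real n powr p * (\<Sum>j<n. c j * f (v j * cis \<theta>)))"
  proof (rule integral_le)
    show "(\<lambda>\<theta>. norm (poly (polar_deriv 0 P) (cis \<theta>)
        + cis \<beta> * (cis \<theta> * poly (pderiv P) (cis \<theta>))) powr p) integrable_on {0..2 * pi}"
      using p
      by (intro integrable_continuous_real continuous_on_powr' continuous_intros) auto
    show "(\<lambda>\<theta>. real n powr p * (\<Sum>j<n. c j * f (v j * cis \<theta>))) integrable_on {0..2 * pi}"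
      by (intro integrable_continuous_real continuous_intros rot)
    show "norm (poly (polar_deriv 0 P) (cis \<theta>) + cis \<beta> * (cis \<theta> * poly (pderiv P) (cis \<theta>))) powr p
        \<le> real n powr p * (\<Sum>j<n. c j * f (v j * cis \<theta>))" for \<theta>
      unfolding formula f_def
      using norm_convex_sum_powr_le[of "{..<n}" c p "\<lambda>j. poly P (v j * cis \<theta>)"] c c_sum p
      by (simp add: norm_mult powr_mult mult_left_mono)
  qed
  also have "\<dots> = real n powr p * (\<Sum>j<n. c j * integral {0..2 * pi} (\<lambda>\<theta>. f (v j * cis \<theta>)))"
    by (simp add: integral_sum integrable_continuous_real rot continuous_on_mult_left)
  also have "\<dots> = real n powr p * integral {0..2 * pi} (\<lambda>\<theta>. f (cis \<theta>))"
    by (simp add: integral_circle_rotate[OF f v] c_sum flip: sum_distrib_right)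
  finally show ?thesis
    by (simp add: f_def)
qed

text \<open>
  The integrand depends on \<open>a\<close> and \<open>b\<close> only through their common modulus and the unimodular
  quotient \<open>b / a\<close>, and a rotation removes the latter.
\<close>

lemma integral_norm_add_cis_mult:
  assumes ab: "norm a = norm b" and p: "p > 0"
  shows "integral {0..2 * pi} (\<lambda>\<beta>. norm (a + cis \<beta> * b) powr p)
    = norm b powr p * integral {0..2 * pi} (\<lambda>\<beta>. norm (1 + cis \<beta>) powr p)"
proof (cases "b = 0")
  case True
  then show ?thesis using ab by simp
next
  case False
  define u where "u = b / a"
  have "a \<noteq> 0" and u: "norm u = 1"
    using False ab by (auto simp: u_def norm_divide)
  have "norm (a + cis \<beta> * b) = norm b * norm (1 + u * cis \<beta>)" for \<beta>
  proof -
    have "a + cis \<beta> * b = a * (1 + u * cis \<beta>)"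
      using \<open>a \<noteq> 0\<close> by (simp add: u_def field_simps)
    then show ?thesis by (simp add: norm_mult ab)
  qed
  then have "integral {0..2 * pi} (\<lambda>\<beta>. norm (a + cis \<beta> * b) powr p)
      = norm b powr p * integral {0..2 * pi} (\<lambda>\<beta>. norm (1 + u * cis \<beta>) powr p)"
    by (simp add: powr_mult)
  also have "integral {0..2 * pi} (\<lambda>\<beta>. norm (1 + u * cis \<beta>) powr p)
      = integral {0..2 * pi} (\<lambda>\<beta>. norm (1 + cis \<beta>) powr p)"
    using p by (intro integral_circle_rotate[of "\<lambda>z. norm (1 + z) powr p"] u
        continuous_on_powr' continuous_intros) auto
  finally show ?thesis .
qed

text \<open>
  Positivity makes \<open>C_const p\<close> a genuine negative power, rather than the conventional value
  \<open>0 powr x = 0\<close>.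
\<close>

lemma integral_norm_one_plus_cis_pos:
  assumes "p > 0"
  shows "integral {0..2 * pi} (\<lambda>\<beta>. norm (1 + cis \<beta>) powr p) > 0"
proof -
  let ?f = "\<lambda>\<beta>. norm (1 + cis \<beta>) powr p"
  have cont: "continuous_on {0..2 * pi} ?f"
    using assms by (intro continuous_on_powr' continuous_intros) auto
  have "integral {0..2 * pi} ?f \<noteq> 0"
  proof
    assume "integral {0..2 * pi} ?f = 0"
    then have "\<forall>\<beta>\<in>{0..2 * pi}. ?f \<beta> = 0"
      using integral_eq_0_iff[OF cont] by simp
    then have "?f 0 = 0"
      by (rule bspec) simp
    then show False by simp
  qed
  moreover have "integral {0..2 * pi} ?f \<ge> 0"
    by (intro integral_nonneg integrable_continuous_real cont) auto
  ultimately show ?thesis by linarith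
qed

text \<open>
  Both sides are compared with the double integral of \<open>|D\<^sub>0 P + w z P'|\<^sup>p\<close> over the circle and
  over \<open>w = cis \<beta>\<close>. Integrating over \<open>w\<close> first gives the left-hand side; integrating over the
  circle first gives at most the right-hand side.
\<close>

lemma self_inversive_integral_pderiv_le:
  assumes P: "self_inversive P" and n: "degree P = n" and p: "p \<ge> 1"
  shows "integral {0..2 * pi} (\<lambda>\<theta>. norm (poly (pderiv P) (cis \<theta>)) powr p)
      * integral {0..2 * pi} (\<lambda>\<beta>. norm (1 + cis \<beta>) powr p)
    \<le> 2 * pi * (real n powr p * integral {0..2 * pi} (\<lambda>\<theta>. norm (poly P (cis \<theta>)) powr p))"
proof -
  define F where "F \<theta> \<beta> =
    norm (poly (polar_deriv 0 P) (cis \<theta>) + cis \<beta> * (cis \<theta> * poly (pderiv P) (cis \<theta>))) powr p" for \<theta> \<beta>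
  define J where "J = integral {0..2 * pi} (\<lambda>\<beta>. norm (1 + cis \<beta>) powr p)"
  define I where "I = integral {0..2 * pi} (\<lambda>\<theta>. norm (poly P (cis \<theta>)) powr p)"
  have F: "continuous_on A (\<lambda>(\<theta>, \<beta>). F \<theta> \<beta>)" for A
    unfolding F_def case_prod_beta using p
    by (intro continuous_on_powr' continuous_intros) auto
  have "integral {0..2 * pi} (\<lambda>\<theta>. norm (poly (pderiv P) (cis \<theta>)) powr p) * J
      = integral {0..2 * pi} (\<lambda>\<theta>. integral {0..2 * pi} (F \<theta>))"
  proof -
    have "integral {0..2 * pi} (F \<theta>) = norm (poly (pderiv P) (cis \<theta>)) powr p * J" for \<theta>
    proof -
      have "norm (poly (polar_deriv 0 P) (cis \<theta>)) = norm (cis \<theta> * poly (pderiv P) (cis \<theta>))"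
        by (simp add: self_inversive_polar_deriv_0[OF P] norm_mult norm_power)
      from integral_norm_add_cis_mult[OF this] p show ?thesis
        by (simp add: F_def[abs_def] J_def norm_mult)
    qed
    then show ?thesis by simp
  qed
  also have "\<dots> = integral {0..2 * pi} (\<lambda>\<beta>. integral {0..2 * pi} (\<lambda>\<theta>. F \<theta> \<beta>))"
    using integral_swap_continuous[of 0 0 "2 * pi" "2 * pi" F] F by simp
  also have "\<dots> \<le> integral {0..2 * pi} (\<lambda>\<beta>. real n powr p * I)"
  proof (rule integral_le)
    have "continuous_on (cbox 0 (2 * pi)) (\<lambda>\<beta>. integral (cbox 0 (2 * pi)) (\<lambda>\<theta>. F \<theta> \<beta>))"
      using continuous_on_compose2[OF F[of UNIV], of _ prod.swap]
      by (intro integral_continuous_on_param)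
        (auto simp: case_prod_beta intro!: continuous_intros)
    then show "(\<lambda>\<beta>. integral {0..2 * pi} (\<lambda>\<theta>. F \<theta> \<beta>)) integrable_on {0..2 * pi}"
      by (intro integrable_continuous_real) simp
    show "integral {0..2 * pi} (\<lambda>\<theta>. F \<theta> \<beta>) \<le> real n powr p * I" for \<beta>
      unfolding F_def I_def by (rule integral_polar_deriv_0_twisted_le[OF n p])
  qed auto
  also have "\<dots> = 2 * pi * (real n powr p * I)"
    by simp
  finally show ?thesis
    unfolding I_def J_def .
qed

theorem theorem3:
  fixes P :: "complex poly" and n :: nat and \<alpha> :: complex and p :: real
  assumes "degree P = n"
    and "self_inversive P"
    and "p \<ge> 1"
  shows "(integral {0..2 * pi}
            (\<lambda>\<theta>. norm (poly (polar_deriv \<alpha> P) (exp (\<i> * of_real \<theta>))) powr p)) powr (1 / p)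
       \<le> real n * (norm \<alpha> + 1) * C_const p *
          (integral {0..2 * pi}
            (\<lambda>\<theta>. norm (poly P (exp (\<i> * of_real \<theta>))) powr p)) powr (1 / p)"
proof -
  define D where "D = integral {0..2 * pi} (\<lambda>\<theta>. norm (poly (polar_deriv \<alpha> P) (cis \<theta>)) powr p)"
  define I where "I = integral {0..2 * pi} (\<lambda>\<theta>. norm (poly P (cis \<theta>)) powr p)"
  define J where "J = integral {0..2 * pi} (\<lambda>\<beta>. norm (1 + cis \<beta>) powr p)"
  define K where "K = integral {0..2 * pi} (\<lambda>\<theta>. norm (poly (pderiv P) (cis \<theta>)) powr p)"
  define L where "L = inverse (J / (2 * pi))"
  have p: "p > 0" using assms(3) by simp
  have J: "J > 0"
    unfolding J_def by (rule integral_norm_one_plus_cis_pos[OF p])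
  have int: "(\<lambda>\<theta>. norm (poly R (cis \<theta>)) powr p) integrable_on {0..2 * pi}" for R
    by (intro integrable_continuous_real continuous_on_circle_param[of "\<lambda>z. norm (poly R z) powr p"]
        continuous_on_norm_poly_powr p)
  have nonneg: "D \<ge> 0" "I \<ge> 0"
    unfolding D_def I_def by (auto intro!: integral_nonneg int)
  have "D \<le> integral {0..2 * pi} (\<lambda>\<theta>. (norm \<alpha> + 1) powr p * norm (poly (pderiv P) (cis \<theta>)) powr p)"
    unfolding D_def
  proof (rule integral_le)
    show "norm (poly (polar_deriv \<alpha> P) (cis \<theta>)) powr p
        \<le> (norm \<alpha> + 1) powr p * norm (poly (pderiv P) (cis \<theta>)) powr p" for \<theta>
      using norm_polar_deriv_le[OF assms(2), of "cis \<theta>" \<alpha>] p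
      by (simp add: powr_mono2 flip: powr_mult)
  qed (intro integrable_on_mult_right int)+
  then have D: "D \<le> (norm \<alpha> + 1) powr p * K"
    by (simp add: K_def)
  have "K * J \<le> 2 * pi * (real n powr p * I)"
    unfolding K_def I_def J_def by (rule self_inversive_integral_pderiv_le[OF assms(2,1,3)])
  then have "K \<le> real n powr p * (L * I)"
    using J by (simp add: L_def field_simps)
  then have "(norm \<alpha> + 1) powr p * K
      \<le> (norm \<alpha> + 1) powr p * (real n powr p * (L * I))"
    by (rule mult_left_mono) simp
  with D have "D \<le> (norm \<alpha> + 1) powr p * (real n powr p * (L * I))"
    by linarith
  then have "D powr (1 / p)
      \<le> ((norm \<alpha> + 1) powr p * (real n powr p * (L * I))) powr (1 / p)"
    using nonneg p by (intro powr_mono2) auto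
  also have "\<dots> = (norm \<alpha> + 1) * (real n * (L powr (1 / p) * I powr (1 / p)))"
    using nonneg J p by (simp add: L_def powr_mult powr_powr del: inverse_divide)
  also have "L powr (1 / p) = C_const p"
    using J unfolding C_const_def cis_conv_exp[symmetric] J_def[symmetric]
    by (simp add: L_def powr_minus powr_divide inverse_eq_divide)
  finally show ?thesis
    by (simp add: D_def I_def cis_conv_exp mult_ac)
qed

end
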